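(* Let $\rho>0$, $\mathcal X=\mathbb S_{++}^p$, and let $\widehat\Sigma\in\mathbb S_+^p$ have the spectral decomposition $\widehat\Sigma=\sum_{i=1}^p\lambda_iv_iv_i^\top$ with eigenvalues $\lambda_i$ and corresponding orthonormal eigenvectors $v_i$, $i\le p$. Then the unique minimizer of the problem $$\inf_{X\in\mathbb S_{++}^p}\Big\{-\log\det X+\sup_{\mathbb Q\in\mathcal P_\rho^0}\mathbb E^{\mathbb Q}\big[\langle\xi\xi^\top,X\rangle\big]\Big\}$$ is given by $X^\star=\sum_{i=1}^px_i^\star v_iv_i^\top$, where $$x_i^\star=\gamma^\star\Big[1-\tfrac12\Big(\sqrt{\lambda_i^2(\gamma^\star)^2+4\lambda_i\gamma^\star}-\lambda_i\gamma^\star\Big)\Big]\qquad\forall i\le p$$ and $\gamma^\star>0$ is the unique positive solution of the algebraic equation $$\Big(\rho^2-\tfrac12\sum_{i=1}^p\lambda_i\Big)\gamma-p+\tfrac12\sum_{i=1}^p\sqrt{\lambda_i^2\gamma^2+4\lambda_i\gamma}=0.$$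
   Context: $\mathbb S_+^p$ ($\mathbb S_{++}^p$) is the cone of symmetric positive semidefinite (positive definite) real $p\times p$ matrices; $\langle A,B\rangle=\mathrm{Tr}[A^\top B]$. $\mathcal N(0,\Sigma)$ denotes the (possibly degenerate) normal distribution on $\mathbb R^p$ with mean $0$ and covariance matrix $\Sigma\in\mathbb S_+^p$, and $\mathcal N_0^p$ is the family of all such zero-mean normal distributions. The type-2 Wasserstein distance between distributions $\mathbb P_1,\mathbb P_2$ on $\mathbb R^p$ with finite second moments is $\mathbb W(\mathbb P_1,\mathbb P_2)=\inf_\Pi\big(\int\|\xi_1-\xi_2\|^2\,\Pi(d\xi_1,d\xi_2)\big)^{1/2}$, where $\Pi$ ranges over all joint distributions with marginals $\mathbb P_1$ and $\mathbb P_2$ and $\|\cdot\|$ is the Euclidean norm. The ambiguity set is $\mathcal P_\rho^0=\{\mathbb Q\in\mathcal N_0^p:\mathbb W(\mathbb Q,\mathcal N(0,\widehat\Sigma))\le\rho\}$. Under $\mathbb E^{\mathbb Q}$, the random vector $\xi\in\mathbb R^p$ has distribution $\mathbb Q$. *)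

theory Defs
  imports "HOL-Probability.Probability"
begin

definition psd :: "(real^'n^'n) set" where
  "psd = {A. transpose A = A \<and> (\<forall>x. 0 \<le> x \<bullet> (A *v x))}"

definition pd :: "(real^'n^'n) set" where
  "pd = {A. transpose A = A \<and> (\<forall>x. x \<noteq> 0 \<longrightarrow> 0 < x \<bullet> (A *v x))}"

definition frob :: "real^'n^'n \<Rightarrow> real^'n^'n \<Rightarrow> real" where
  "frob A B = trace (transpose A ** B)"

definition outer :: "real^'n \<Rightarrow> real^'n \<Rightarrow> real^'n^'n" where
  "outer x y = (\<chi> i j. x $ i * y $ j)"

(* The unique positive semidefinite square root; only meaningful for A in psd. *)
definition psd_sqrt :: "real^'n^'n \<Rightarrow> real^'n^'n" where
  "psd_sqrt A = (THE S. S \<in> psd \<and> S ** S = A)"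

(* The possibly degenerate normal distribution with mean 0 and covariance matrix S in psd: the law
   of S^(1/2) Z, where the components of Z are independent standard normal variables. *)
definition normal0 :: "real^'n^'n \<Rightarrow> (real^'n) measure" where
  "normal0 S = distr (PiM (UNIV :: 'n set) (\<lambda>_. density lborel std_normal_density)) borel
                 (\<lambda>z. psd_sqrt S *v (\<chi> i. z i))"

definition normals0 :: "(real^'n) measure set" where
  "normals0 = normal0 ` psd"

definition couplings ::
  "(real^'n) measure \<Rightarrow> (real^'n) measure \<Rightarrow> ((real^'n) \<times> (real^'n)) measure set" where
  "couplings P1 P2 = {C. prob_space C \<and> sets C = sets (borel \<Otimes>\<^sub>M borel) \<and>
                         distr C borel fst = P1 \<and> distr C borel snd = P2}"

(* For Borel probability measures P1, P2 with finite second moments: then the integrand is integrable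
   under every coupling, and the set of couplings is nonempty (it contains the product measure), so
   that neither the integral nor the infimum takes a default value. *)
definition wasserstein2 :: "(real^'n) measure \<Rightarrow> (real^'n) measure \<Rightarrow> real" where
  "wasserstein2 P1 P2 =
     (INF C\<in>couplings P1 P2. sqrt (\<integral>w. (norm (fst w - snd w))\<^sup>2 \<partial>C))"

definition ambiguity :: "real \<Rightarrow> real^'n^'n \<Rightarrow> (real^'n) measure set" where
  "ambiguity \<rho> S = {Q \<in> normals0. wasserstein2 Q (normal0 S) \<le> \<rho>}"

(* Extended-real valued, so that the supremum needs no boundedness side condition. The expectation
   is finite for every Q in normals0. *)
definition objective :: "real \<Rightarrow> real^'n^'n \<Rightarrow> real^'n^'n \<Rightarrow> ereal" where
  "objective \<rho> S X = ereal (- ln (det X)) +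
     (SUP Q\<in>ambiguity \<rho> S. ereal (\<integral>\<xi>. frob (outer \<xi> \<xi>) X \<partial>Q))"

definition gamma_eq :: "real \<Rightarrow> ('n::finite \<Rightarrow> real) \<Rightarrow> real \<Rightarrow> bool" where
  "gamma_eq \<rho> lam \<gamma> \<longleftrightarrow>
     (\<rho>\<^sup>2 - 1/2 * (\<Sum>i\<in>UNIV. lam i)) * \<gamma> - real CARD('n)
       + 1/2 * (\<Sum>i\<in>UNIV. sqrt ((lam i)\<^sup>2 * \<gamma>\<^sup>2 + 4 * lam i * \<gamma>)) = 0"

definition xstar :: "('n \<Rightarrow> real) \<Rightarrow> real \<Rightarrow> 'n \<Rightarrow> real" where
  "xstar lam \<gamma> i =
     \<gamma> * (1 - 1/2 * (sqrt ((lam i)\<^sup>2 * \<gamma>\<^sup>2 + 4 * lam i * \<gamma>) - lam i * \<gamma>))"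

end

theory Submission
  imports Defs
begin

text \<open>The problem is a zero-sum game between the matrix \<open>X\<close> and the distribution \<open>Q\<close>, and the proof exhibits
a saddle point of it that is diagonal in the eigenbasis \<open>v\<close> of \<open>S\<close>. Let \<open>p\<close> be the dimension, write \<open>a\<^sub>i = \<lambda>\<^sub>i \<gamma>\<close> and
\<open>t\<^sub>i = shrinkage a\<^sub>i\<close> for the nonnegative root of \<open>t\<^sup>2 = a\<^sub>i (1 - t)\<close>. Then \<open>x\<^sub>i = \<gamma> (1 - t\<^sub>i)\<close>, and the
equation for \<open>\<gamma>\<close> becomes \<open>\<gamma> \<rho>\<^sup>2 + \<Sum> t\<^sub>i = p\<close>, whose left-hand side increases strictly from 0; this gives
the unique \<open>\<gamma>\<close> (\<open>gamma_eq_unique_solution\<close>). Let \<open>X\<^sup>*\<close> be the matrix with eigenvalues \<open>x\<^sub>i\<close>.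

Lower bound. The normal distribution with covariance matrix \<open>T = (X\<^sup>*)\<^sup>-\<^sup>1\<close> is a feasible adversary: \<open>T\<close> and
\<open>S\<close> commute, and the coupling of \<open>T\<^sup>1\<^sup>/\<^sup>2 Z\<close> with \<open>S\<^sup>1\<^sup>/\<^sup>2 Z\<close> for one standard normal \<open>Z\<close> has cost exactly
\<open>\<rho>\<^sup>2\<close> (\<open>worst_case_distribution_mem_ambiguity\<close>). So every positive definite \<open>X\<close> has objective at least
\<open>tr (T\<^sup>1\<^sup>/\<^sup>2 X T\<^sup>1\<^sup>/\<^sup>2) - ln det X\<close>. Since \<open>ln det Y \<le> tr Y - p\<close> for positive definite \<open>Y\<close>, with equality only at
the identity matrix (\<open>ln_det_le_trace\<close>), this is at least \<open>p - ln det X\<^sup>*\<close>, with equality only at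
\<open>X = X\<^sup>*\<close> (\<open>log_det_trace_bound\<close>).

Upper bound. The objective at \<open>X\<^sup>*\<close> is at most \<open>p - ln det X\<^sup>*\<close>, by Lagrangian weak duality with
multiplier \<open>\<gamma>\<close> (\<open>worst_case_expectation_le\<close>): for a coupling of \<open>\<xi>\<^sub>1\<close> with \<open>\<xi>\<^sub>2\<close>, maximizing the quadratic
\<open>\<xi>\<^sub>1\<cdot>X\<^sup>*\<xi>\<^sub>1 - \<gamma> |\<xi>\<^sub>1 - \<xi>\<^sub>2|\<^sup>2\<close> over \<open>\<xi>\<^sub>1\<close> coordinate by coordinate, for \<open>\<xi>\<^sub>2\<close> in the range of \<open>S\<close>, where it lies almost
surely, leaves a quadratic form in \<open>\<xi>\<^sub>2\<close> whose expectation depends on \<open>S\<close> only and equals \<open>\<Sum> t\<^sub>i\<close>.\<close>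

section \<open>Matrices diagonal in an orthonormal frame\<close>

definition orthonormal :: "('n::finite \<Rightarrow> real^'n) \<Rightarrow> bool" where
  "orthonormal v \<longleftrightarrow> (\<forall>i j. v i \<bullet> v j = (if i = j then 1 else 0))"

definition spectral_sum :: "('n::finite \<Rightarrow> real^'n) \<Rightarrow> ('n \<Rightarrow> real) \<Rightarrow> real^'n^'n" where
  "spectral_sum v d = (\<Sum>i\<in>UNIV. d i *\<^sub>R outer (v i) (v i))"

lemma orthonormal_inner: "orthonormal v \<Longrightarrow> v i \<bullet> v j = (if i = j then 1 else 0)"
  by (simp add: orthonormal_def)

lemma spectral_sum_mult_vec:
  "spectral_sum v d *v x = (\<Sum>i\<in>UNIV. (d i * (v i \<bullet> x)) *\<^sub>R v i)"
proof -
  have "(\<Sum>j\<in>UNIV. (\<Sum>i\<in>UNIV. d i * (v i $ k * v i $ j)) * x $ j)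
      = (\<Sum>i\<in>UNIV. d i * (\<Sum>j\<in>UNIV. v i $ j * x $ j) * v i $ k)" for k
    unfolding sum_distrib_left sum_distrib_right
    by (subst sum.swap) (simp only: mult_ac)
  then show ?thesis
    by (simp add: spectral_sum_def vec_eq_iff matrix_vector_mult_def outer_def inner_vec_def)
qed

lemma spectral_sum_eq_conjugated_diagonal:
  "spectral_sum v d = transpose (\<chi> i. v i) ** (\<chi> i j. if i = j then d i else 0) ** (\<chi> i. v i)"
  unfolding spectral_sum_def vec_eq_iff matrix_matrix_mult_def outer_def transpose_def
  by (simp add: if_distrib[of "\<lambda>a. _ * a"] mult_ac cong: if_cong)

lemma orthonormal_rows_mult_transpose:
  assumes "orthonormal v"
  shows "(\<chi> i. v i) ** transpose (\<chi> i. v i) = mat 1"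
  using assms unfolding orthonormal_def
  by (simp add: vec_eq_iff matrix_matrix_mult_def transpose_def mat_def inner_vec_def)

lemma orthonormal_transpose_mult_rows:
  assumes "orthonormal v"
  shows "transpose (\<chi> i. v i) ** (\<chi> i. v i) = mat 1"
  using orthonormal_rows_mult_transpose[OF assms] matrix_left_right_inverse by blast

lemma spectral_sum_1: "orthonormal v \<Longrightarrow> spectral_sum v (\<lambda>i. 1) = mat 1"
  using orthonormal_transpose_mult_rows[of v]
  by (simp add: spectral_sum_def vec_eq_iff matrix_matrix_mult_def transpose_def outer_def)

lemma orthonormal_expansion:
  assumes "orthonormal v"
  shows "(\<Sum>i\<in>UNIV. (v i \<bullet> x) *\<^sub>R v i) = x"
  using spectral_sum_mult_vec[of v "\<lambda>i. 1" x] by (simp add: spectral_sum_1[OF assms])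

lemma orthonormal_parseval:
  assumes "orthonormal v"
  shows "x \<bullet> y = (\<Sum>i\<in>UNIV. (v i \<bullet> x) * (v i \<bullet> y))"
proof -
  have "x \<bullet> y = (\<Sum>i\<in>UNIV. (v i \<bullet> x) *\<^sub>R v i) \<bullet> y"
    by (simp add: orthonormal_expansion[OF assms])
  then show ?thesis by (simp add: inner_sum_left)
qed

text \<open>An orthonormal family indexed by the coordinates spans the whole space. Identities between matrices with
known eigenvectors can therefore be checked on these vectors, without computing with entries.\<close>
lemma matrix_eq_on_orthonormal:
  assumes v: "orthonormal v" and eq: "\<And>i. A *v v i = B *v v i"
  shows "A = B"
proof -
  have "A *v x = B *v x" for x
  proof -
    have "A *v (\<Sum>i\<in>UNIV. (v i \<bullet> x) *\<^sub>R v i) = B *v (\<Sum>i\<in>UNIV. (v i \<bullet> x) *\<^sub>R v i)"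
      by (simp add: linear_sum[OF matrix_vector_mul_linear] matrix_vector_mult_scaleR eq)
    then show ?thesis by (simp only: orthonormal_expansion[OF v])
  qed
  then show ?thesis by (simp add: matrix_eq)
qed

lemma spectral_sum_eigenvector:
  assumes "orthonormal v"
  shows "spectral_sum v d *v v i = d i *\<^sub>R v i"
  by (simp add: spectral_sum_mult_vec orthonormal_inner[OF assms]
      if_distrib[of "\<lambda>a. _ * a"] if_distrib[of "\<lambda>a. a *\<^sub>R _"] cong: if_cong)

lemma spectral_sum_mult:
  assumes "orthonormal v"
  shows "spectral_sum v c ** spectral_sum v d = spectral_sum v (\<lambda>i. c i * d i)"
  by (rule matrix_eq_on_orthonormal[OF assms])
     (simp add: spectral_sum_eigenvector[OF assms] matrix_vector_mul_assoc[symmetric]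
       matrix_vector_mult_scaleR mult.commute)

lemma transpose_spectral_sum: "transpose (spectral_sum v d) = spectral_sum v d"
  by (simp add: spectral_sum_def vec_eq_iff transpose_def outer_def mult_ac)

lemma quadratic_form_spectral_sum:
  "x \<bullet> (spectral_sum v d *v x) = (\<Sum>i\<in>UNIV. d i * (v i \<bullet> x)\<^sup>2)"
  by (simp add: spectral_sum_mult_vec inner_sum_right power2_eq_square inner_commute mult_ac)

lemma trace_spectral_sum:
  assumes "orthonormal v"
  shows "trace (spectral_sum v d) = (\<Sum>i\<in>UNIV. d i)"
proof -
  have "trace (spectral_sum v d) = (\<Sum>i\<in>UNIV. d i * (v i \<bullet> v i))"
    unfolding trace_def spectral_sum_def outer_def inner_vec_def
    by (simp add: sum_distrib_left) (rule sum.swap)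
  then show ?thesis by (simp add: orthonormal_inner[OF assms])
qed

lemma det_spectral_sum:
  assumes "orthonormal v"
  shows "det (spectral_sum v d) = (\<Prod>i\<in>UNIV. d i)"
proof -
  let ?V = "(\<chi> i. v i) :: real^'a^'a" and ?D = "(\<chi> i j. if i = j then d i else 0) :: real^'a^'a"
  have "det ?V * det (transpose ?V) = 1"
    using orthonormal_rows_mult_transpose[OF assms] by (metis det_I det_mul)
  moreover have "det ?D = (\<Prod>i\<in>UNIV. d i)"
    by (subst det_diagonal) auto
  ultimately show ?thesis
    unfolding spectral_sum_eq_conjugated_diagonal det_mul by (simp add: algebra_simps)
qed

lemma spectral_sum_mem_psd:
  assumes "\<And>i. d i \<ge> 0"
  shows "spectral_sum v d \<in> psd"
  using assms by (auto simp: psd_def transpose_spectral_sum quadratic_form_spectral_sum intro!: sum_nonneg)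

lemma spectral_sum_mem_pd:
  assumes v: "orthonormal v" and d: "\<And>i. d i > 0"
  shows "spectral_sum v d \<in> pd"
proof -
  have "0 < x \<bullet> (spectral_sum v d *v x)" if "x \<noteq> 0" for x
  proof -
    have "\<exists>i. v i \<bullet> x \<noteq> 0"
    proof (rule ccontr)
      assume "\<nexists>i. v i \<bullet> x \<noteq> 0"
      with orthonormal_expansion[OF v, of x] \<open>x \<noteq> 0\<close> show False by simp
    qed
    then obtain i where "v i \<bullet> x \<noteq> 0" ..
    then have "0 < d i * (v i \<bullet> x)\<^sup>2" by (simp add: d)
    then show ?thesis
      unfolding quadratic_form_spectral_sum
      by (intro sum_pos2[of UNIV i]) (auto simp: d less_imp_le)
  qed
  then show ?thesis by (simp add: pd_def transpose_spectral_sum)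
qed

text \<open>Any positive semidefinite \<open>R\<close> with \<open>R\<^sup>2 v\<^sub>i = d\<^sub>i v\<^sub>i\<close> satisfies \<open>R v\<^sub>i = \<surd>d\<^sub>i v\<^sub>i\<close>: the defect
\<open>w = R v\<^sub>i - \<surd>d\<^sub>i v\<^sub>i\<close> fulfils \<open>R w = - \<surd>d\<^sub>i w\<close>, which positivity of \<open>R\<close> forbids unless \<open>w = 0\<close> when \<open>d\<^sub>i > 0\<close>,
while for \<open>d\<^sub>i = 0\<close> the norm of \<open>w = R v\<^sub>i\<close> vanishes because \<open>R w = 0\<close>. This is the uniqueness that
the definite description in \<^const>\<open>psd_sqrt\<close> asks for.\<close>
lemma psd_sqrt_spectral_sum:
  assumes v: "orthonormal v" and d: "\<And>i. d i \<ge> 0"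
  shows "psd_sqrt (spectral_sum v d) = spectral_sum v (\<lambda>i. sqrt (d i))"
  unfolding psd_sqrt_def
proof (rule the_equality)
  show "spectral_sum v (\<lambda>i. sqrt (d i)) \<in> psd \<and>
      spectral_sum v (\<lambda>i. sqrt (d i)) ** spectral_sum v (\<lambda>i. sqrt (d i)) = spectral_sum v d"
    by (simp add: spectral_sum_mem_psd spectral_sum_mult[OF v] d)
next
  fix R assume R: "R \<in> psd \<and> R ** R = spectral_sum v d"
  have "R *v v i = sqrt (d i) *\<^sub>R v i" for i
  proof -
    define w where "w = R *v v i - sqrt (d i) *\<^sub>R v i"
    have RR: "R *v (R *v v i) = d i *\<^sub>R v i"
      using R by (simp add: matrix_vector_mul_assoc spectral_sum_eigenvector[OF v])
    have Rw: "R *v w = - sqrt (d i) *\<^sub>R w"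
      by (simp add: w_def RR matrix_vector_mult_diff_distrib matrix_vector_mult_scaleR
          scaleR_diff_right d)
    have "w = 0"
    proof (cases "d i = 0")
      case True
      have "w \<bullet> w = v i \<bullet> (R *v w)"
        using R True by (simp add: w_def psd_def) (metis dot_lmul_matrix transpose_matrix_vector)
      then show ?thesis using Rw True by simp
    next
      case False
      have "0 \<le> w \<bullet> (R *v w)" using R by (simp add: psd_def)
      then have "sqrt (d i) * (w \<bullet> w) \<le> 0" unfolding Rw by simp
      moreover have "sqrt (d i) > 0" using False d[of i] by simp
      ultimately have "w \<bullet> w \<le> 0" by (simp add: mult_le_0_iff)
      then show ?thesis by (metis inner_gt_zero_iff not_less)
    qed
    then show ?thesis by (simp add: w_def)
  qed
  then show "R = spectral_sum v (\<lambda>i. sqrt (d i))"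
    by (intro matrix_eq_on_orthonormal[OF v]) (simp add: spectral_sum_eigenvector[OF v])
qed

lemma pd_symmetric: "A \<in> pd \<Longrightarrow> x \<bullet> (A *v y) = (A *v x) \<bullet> y"
  unfolding pd_def by (metis (mono_tags, lifting) dot_lmul_matrix mem_Collect_eq transpose_matrix_vector)

section \<open>Spectral theorem and the log-determinant inequality\<close>

lemma linear_coeff_eq_0_if_quadratic_nonneg:
  fixes a b :: real
  assumes "\<And>t. 0 \<le> 2 * t * b + t\<^sup>2 * a"
  shows "b = 0"
proof -
  \<comment> \<open>This \<open>t\<close> minimizes \<open>2 t b + t\<^sup>2 (\<bar>a\<bar> + 1)\<close>, where the leading coefficient is safely positive.\<close>
  define t where "t = - b / (\<bar>a\<bar> + 1)"
  have t: "t * (\<bar>a\<bar> + 1) = - b" by (simp add: t_def add_nonneg_eq_0_iff)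
  have "0 \<le> 2 * t * b + t\<^sup>2 * a" by (rule assms)
  also have "\<dots> \<le> 2 * t * b + t\<^sup>2 * (\<bar>a\<bar> + 1)"
    by (intro add_left_mono mult_left_mono) auto
  also have "\<dots> = t * b"
    by (simp add: power2_eq_square mult.assoc t)
  also have "\<dots> = - (t\<^sup>2 * (\<bar>a\<bar> + 1))"
    by (simp add: power2_eq_square mult.assoc t)
  finally have "t\<^sup>2 * (\<bar>a\<bar> + 1) \<le> 0" by simp
  then have "t = 0" using abs_ge_zero[of a] by (auto simp: mult_le_0_iff)
  then show ?thesis using t by simp
qed

text \<open>A maximizer \<open>u\<close> of the Rayleigh quotient on the invariant subspace \<open>W\<close> orthogonal to \<open>B\<close> is an
eigenvector. With the maximal value \<open>c\<close>, the form \<open>q x = c |x|\<^sup>2 - x\<cdot>Ax\<close> is nonnegative on \<open>W\<close> and vanishes at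
\<open>u\<close>, so its derivative at \<open>u\<close> vanishes in every direction of \<open>W\<close>; the direction \<open>w = c u - A u\<close>, which lies in
\<open>W\<close> itself, gives \<open>|w|\<^sup>2 = 0\<close>.\<close>
lemma unit_eigenvector_orthogonal_to_eigenvectors:
  fixes A :: "real^'n^'n"
  assumes A: "transpose A = A"
    and B: "\<And>b. b \<in> B \<Longrightarrow> \<exists>c. A *v b = c *\<^sub>R b"
    and dim: "dim B < CARD('n)"
  shows "\<exists>u c. norm u = 1 \<and> (\<forall>b\<in>B. b \<bullet> u = 0) \<and> A *v u = c *\<^sub>R u"
proof -
  define W where "W = {x. \<forall>b\<in>B. b \<bullet> x = 0}"
  have sym: "x \<bullet> (A *v y) = (A *v x) \<bullet> y" for x y
    using A by (metis dot_lmul_matrix transpose_matrix_vector)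
  have W_comb: "a *\<^sub>R x + b *\<^sub>R y \<in> W" if "x \<in> W" "y \<in> W" for a b x y
    using that by (simp add: W_def inner_add_right)
  have W_A: "A *v x \<in> W" if "x \<in> W" for x
    unfolding W_def
  proof (intro CollectI ballI)
    fix b assume b: "b \<in> B"
    obtain c where "A *v b = c *\<^sub>R b" using B[OF b] by blast
    then show "b \<bullet> (A *v x) = 0" using that b by (simp add: sym W_def)
  qed
  define K where "K = sphere 0 1 \<inter> W"
  have "closed W"
  proof -
    have "W = (\<Inter>b\<in>B. {x. b \<bullet> x = 0})" by (auto simp: W_def)
    then show ?thesis by (simp add: closed_hyperplane closed_INT)
  qed
  then have "compact K"
    unfolding K_def by (intro compact_Int_closed compact_sphere)
  moreover have "K \<noteq> {}"
  proof -
    obtain x where x: "x \<noteq> 0" "\<And>y. y \<in> span B \<Longrightarrow> orthogonal x y"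
      using orthogonal_to_subspace_exists[of B] dim by auto
    then have "(1 / norm x) *\<^sub>R x \<in> K"
      by (auto simp: K_def W_def orthogonal_def span_base inner_commute)
    then show ?thesis by blast
  qed
  moreover have "continuous_on K (\<lambda>x. x \<bullet> (A *v x))"
    by (intro continuous_intros linear_continuous_on linear_linear[THEN iffD2] matrix_vector_mul_linear)
  ultimately obtain u where u: "u \<in> K" and max: "\<And>x. x \<in> K \<Longrightarrow> x \<bullet> (A *v x) \<le> u \<bullet> (A *v u)"
    using continuous_attains_sup by metis
  define c where "c = u \<bullet> (A *v u)"
  have uu: "u \<bullet> u = 1" and uW: "u \<in> W" using u by (auto simp: K_def norm_eq_1)
  define q where "q x = c * (x \<bullet> x) - x \<bullet> (A *v x)" for x
  have q_nonneg: "q x \<ge> 0" if x: "x \<in> W" for x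
  proof (cases "x = 0")
    case False
    have "(1 / norm x) *\<^sub>R x \<in> K"
      using W_comb[OF x x, of "1 / norm x" 0] False by (simp add: K_def)
    from max[OF this] have "(x \<bullet> (A *v x)) / (norm x)\<^sup>2 \<le> c"
      by (simp add: c_def matrix_vector_mult_scaleR power2_eq_square)
    then show ?thesis
      using False by (simp add: q_def divide_le_eq power2_norm_eq_inner mult.commute)
  qed (simp add: q_def)
  define w where "w = c *\<^sub>R u - A *v u"
  have wW: "w \<in> W"
    using W_comb[OF uW W_A[OF uW], of c "-1"] by (simp add: w_def)
  \<comment> \<open>The linear coefficient of this polynomial in \<open>t\<close> is the derivative of \<open>q\<close> at \<open>u\<close> in the direction \<open>w\<close>.\<close>
  have "q (u + t *\<^sub>R w) = 2 * t * (w \<bullet> w) + t\<^sup>2 * q w" for t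
  proof -
    have "q (u + t *\<^sub>R w) = q u + 2 * t * (w \<bullet> (c *\<^sub>R u - A *v u)) + t\<^sup>2 * q w"
      by (simp add: q_def inner_add_left inner_add_right inner_diff_right matrix_vector_right_distrib
          matrix_vector_mult_scaleR sym[of u w] inner_commute[of "A *v u" w] inner_commute[of u w]
          power2_eq_square algebra_simps)
    also have "q u = 0" by (simp add: q_def uu c_def)
    finally show ?thesis by (simp only: w_def[symmetric] add_0)
  qed
  moreover have "q (u + t *\<^sub>R w) \<ge> 0" for t
    using q_nonneg[OF W_comb[OF uW wW, of 1 t]] by simp
  ultimately have quad: "0 \<le> 2 * t * (w \<bullet> w) + t\<^sup>2 * q w" for t by metis
  have "w \<bullet> w = 0" using quad by (rule linear_coeff_eq_0_if_quadratic_nonneg)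
  then have "A *v u = c *\<^sub>R u" by (simp add: w_def)
  moreover have "norm u = 1" using u by (simp add: K_def)
  ultimately show ?thesis using uW by (auto simp: W_def)
qed

text \<open>Orthonormal sets of eigenvectors can be enlarged one vector at a time until they have as many elements
as the index type, which then labels them.\<close>
theorem spectral_theorem_symmetric:
  fixes A :: "real^'n^'n"
  assumes A: "transpose A = A"
  obtains u d where "orthonormal u" "A = spectral_sum u d"
proof -
  have "\<exists>B. finite B \<and> card B = k \<and> pairwise orthogonal B \<and>
      (\<forall>b\<in>B. norm b = 1 \<and> (\<exists>c. A *v b = c *\<^sub>R b))" if "k \<le> CARD('n)" for k
    using that
  proof (induction k)
    case 0
    show ?case by (intro exI[of _ "{}"]) auto
  next
    case (Suc k)
    then obtain B where B: "finite B" "card B = k" "pairwise orthogonal B"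
      "\<And>b. b \<in> B \<Longrightarrow> norm b = 1" "\<And>b. b \<in> B \<Longrightarrow> \<exists>c. A *v b = c *\<^sub>R b"
      by auto
    have "dim B < CARD('n)"
      using dim_le_card'[OF B(1)] B(2) Suc.prems by simp
    then obtain u c where u: "norm u = 1" "\<forall>b\<in>B. b \<bullet> u = 0" "A *v u = c *\<^sub>R u"
      using unit_eigenvector_orthogonal_to_eigenvectors[OF A B(5)] by blast
    have "u \<notin> B" using u by (metis norm_eq_1 zero_neq_one)
    moreover have "pairwise orthogonal (insert u B)"
      using B(3) u(2) by (auto simp: pairwise_insert orthogonal_def inner_commute)
    ultimately show ?case
      using B u by (intro exI[of _ "insert u B"]) auto
  qed
  from this[of "CARD('n)"] obtain B where B: "finite B" "card B = CARD('n)" "pairwise orthogonal B"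
      "\<And>b. b \<in> B \<Longrightarrow> norm b = 1" "\<And>b. b \<in> B \<Longrightarrow> \<exists>c. A *v b = c *\<^sub>R b"
    by auto
  obtain u :: "'n \<Rightarrow> real^'n" where u: "bij_betw u UNIV B"
    using finite_same_card_bij[of "UNIV :: 'n set" B] B by auto
  have uB: "u i \<in> B" for i using u by (auto simp: bij_betw_def)
  have "u i \<bullet> u j = (if i = j then 1 else 0)" for i j
    using B(3,4) uB[of i] uB[of j] bij_betw_imp_inj_on[OF u]
    by (auto simp: pairwise_def orthogonal_def inj_eq norm_eq_1[symmetric])
  then have on: "orthonormal u" by (simp add: orthonormal_def)
  obtain d where d: "\<And>i. A *v u i = d i *\<^sub>R u i"
    using B(5)[OF uB] by metis
  have "A = spectral_sum u d"
    by (rule matrix_eq_on_orthonormal[OF on]) (simp add: d spectral_sum_eigenvector[OF on])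
  with on show thesis by (rule that)
qed

lemma pd_eigenvalue_pos:
  assumes u: "orthonormal u" and pd: "spectral_sum u d \<in> pd"
  shows "d i > 0"
proof -
  have "u i \<noteq> 0" using orthonormal_inner[OF u, of i i] by auto
  then have "0 < u i \<bullet> (spectral_sum u d *v u i)" using pd by (simp add: pd_def)
  then show ?thesis by (simp add: spectral_sum_eigenvector[OF u] orthonormal_inner[OF u])
qed

lemma pd_spectral_decomposition:
  assumes "A \<in> pd"
  obtains u d where "orthonormal u" "A = spectral_sum u d" "\<And>i. d i > 0"
proof -
  have "transpose A = A" using assms by (simp add: pd_def)
  then obtain u d where "orthonormal u" "A = spectral_sum u d"
    using spectral_theorem_symmetric by blast
  with assms that show thesis by (auto intro: pd_eigenvalue_pos)
qed

lemma pd_det_pos: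
  assumes "A \<in> pd"
  shows "det A > 0"
  using pd_spectral_decomposition[OF assms] by (metis det_spectral_sum prod_pos)

text \<open>In terms of the eigenvalues \<open>d\<^sub>i\<close> this is the sum over \<open>i\<close> of \<open>ln d\<^sub>i \<le> d\<^sub>i - 1\<close>, where equality holds only
for \<open>d\<^sub>i = 1\<close>.\<close>
lemma ln_det_le_trace:
  fixes A :: "real^'n^'n"
  assumes A: "A \<in> pd"
  shows "ln (det A) \<le> trace A - CARD('n)"
    and "ln (det A) = trace A - CARD('n) \<Longrightarrow> A = mat 1"
proof -
  obtain u d where u: "orthonormal u" and Ad: "A = spectral_sum u d" and d: "\<And>i. d i > 0"
    using pd_spectral_decomposition[OF A] by blast
  have ln: "ln (det A) = (\<Sum>i\<in>UNIV. ln (d i))"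
    unfolding Ad det_spectral_sum[OF u] by (intro ln_prod) (auto simp: d less_imp_neq[THEN not_sym])
  have tr: "trace A - CARD('n) = (\<Sum>i\<in>UNIV. d i - 1)"
    by (simp add: Ad trace_spectral_sum[OF u] sum_subtractf)
  show "ln (det A) \<le> trace A - CARD('n)"
    unfolding ln tr by (intro sum_mono ln_le_minus_one d)
  assume "ln (det A) = trace A - CARD('n)"
  then have "(\<Sum>i\<in>UNIV. (d i - 1) - ln (d i)) = 0"
    unfolding ln tr by (simp add: sum_subtractf)
  then have "d i - 1 - ln (d i) = 0" for i
    by (subst (asm) sum_nonneg_eq_0_iff) (auto simp: ln_le_minus_one d)
  then have "d = (\<lambda>i. 1)"
    using ln_eq_minus_one d by (metis (no_types, lifting) ext eq_iff_diff_eq_0)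
  then show "A = mat 1" by (simp add: Ad spectral_sum_1[OF u])
qed

lemma pd_congruence:
  assumes v: "orthonormal v" and d: "\<And>i. d i > 0" and X: "X \<in> pd"
  shows "spectral_sum v d ** X ** spectral_sum v d \<in> pd"
proof -
  let ?A = "spectral_sum v d"
  have "0 < x \<bullet> ((?A ** X ** ?A) *v x)" if "x \<noteq> 0" for x
  proof -
    have pdA: "?A \<in> pd" by (rule spectral_sum_mem_pd[OF v d])
    have "?A *v x \<noteq> 0" using pdA that by (auto simp: pd_def)
    then have "0 < (?A *v x) \<bullet> (X *v (?A *v x))" using X by (simp add: pd_def)
    then show ?thesis
      by (simp add: matrix_vector_mul_assoc[symmetric] pd_symmetric[OF pdA])
  qed
  then show ?thesis using X
    by (simp add: pd_def matrix_transpose_mul transpose_spectral_sum matrix_mul_assoc)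
qed

lemma spectral_sum_sqrt_inverse_square:
  assumes v: "orthonormal v" and x: "\<And>i. x i > 0"
  defines "A \<equiv> spectral_sum v (\<lambda>i. sqrt (1 / x i))"
  shows "A ** A ** spectral_sum v x = mat 1" "spectral_sum v x ** A ** A = mat 1"
proof -
  have "sqrt (1 / x i) * (sqrt (1 / x i) * x i) = 1" for i
    using x[of i] by (simp add: real_sqrt_divide less_imp_le flip: mult.assoc)
  then show "A ** A ** spectral_sum v x = mat 1" "spectral_sum v x ** A ** A = mat 1"
    by (simp_all add: A_def spectral_sum_mult[OF v] spectral_sum_1[OF v] mult_ac)
qed

text \<open>Apply \<open>ln_det_le_trace\<close> to the congruent matrix \<open>Y = A X A\<close>, where \<open>A\<^sup>2\<close> inverts the matrix \<open>spectral_sum v x\<close>; the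
determinants of \<open>Y\<close> and \<open>X\<close> differ by the constant factor \<open>det A\<^sup>2\<close>, and \<open>Y\<close> is the identity exactly for
\<open>X = spectral_sum v x\<close>.\<close>
lemma log_det_trace_bound:
  fixes v :: "'n::finite \<Rightarrow> real^'n"
  assumes v: "orthonormal v" and x: "\<And>i. x i > 0" and X: "X \<in> pd"
  defines "A \<equiv> spectral_sum v (\<lambda>i. sqrt (1 / x i))"
  shows "CARD('n) - ln (det (spectral_sum v x)) \<le> trace (A ** X ** A) - ln (det X)"
    and "trace (A ** X ** A) - ln (det X) = CARD('n) - ln (det (spectral_sum v x)) \<Longrightarrow>
      X = spectral_sum v x"
proof -
  let ?Y = "A ** X ** A" and ?X = "spectral_sum v x"
  note inverse = spectral_sum_sqrt_inverse_square[of v x, OF v x, folded A_def]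
  have Y: "?Y \<in> pd" unfolding A_def by (rule pd_congruence[OF v _ X]) (simp add: x)
  have X'_pos: "det ?X > 0" by (simp add: det_spectral_sum[OF v] prod_pos x)
  have "det A * det A * det ?X = 1"
    using arg_cong[OF inverse(1), of det] by (simp add: det_mul)
  then have "det ?Y * det ?X = det X"
    by (simp add: det_mul)
  then have "ln (det X) = ln (det ?Y) + ln (det ?X)"
    using ln_mult_pos[OF pd_det_pos[OF Y] X'_pos] by simp
  then have eq: "trace ?Y - ln (det X) - (CARD('n) - ln (det ?X)) = trace ?Y - CARD('n) - ln (det ?Y)"
    by simp
  show "CARD('n) - ln (det ?X) \<le> trace ?Y - ln (det X)"
    using ln_det_le_trace(1)[OF Y] eq by linarith
  assume "trace ?Y - ln (det X) = CARD('n) - ln (det ?X)"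
  with eq have "ln (det ?Y) = trace ?Y - CARD('n)" by linarith
  then have Y1: "?Y = mat 1" by (rule ln_det_le_trace(2)[OF Y])
  have "X = (?X ** A ** A) ** X ** (A ** A ** ?X)" by (simp add: inverse)
  also have "\<dots> = ?X ** A ** ?Y ** A ** ?X" by (simp only: matrix_mul_assoc)
  also have "\<dots> = ?X" unfolding Y1 by (simp add: inverse)
  finally show "X = ?X" .
qed

section \<open>Second moments and couplings of normal distributions\<close>

abbreviation std_gauss :: "('n::finite \<Rightarrow> real) measure" where
  "std_gauss \<equiv> PiM UNIV (\<lambda>_. density lborel std_normal_density)"

lemma prob_space_std_gauss: "prob_space (std_gauss :: ('n::finite \<Rightarrow> real) measure)"
  by (intro prob_space_PiM prob_space_normal_density) simp

lemma std_gauss_component_measurable [measurable]: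
  "(\<lambda>z. z i) \<in> borel_measurable (std_gauss :: ('n::finite \<Rightarrow> real) measure)"
proof -
  have "(\<lambda>z. z i) \<in> std_gauss \<rightarrow>\<^sub>M (density lborel std_normal_density)"
    by (rule measurable_component_singleton) simp
  then show ?thesis by simp
qed

lemma std_gauss_vec_measurable [measurable]:
  "(\<lambda>z. \<chi> i. z i) \<in> borel_measurable (std_gauss :: ('n::finite \<Rightarrow> real) measure)"
  by (subst borel_measurable_euclidean_space) (auto simp: Basis_vec_def inner_axis)

lemma matrix_vector_mult_measurable [measurable]:
  "(\<lambda>x. A *v x) \<in> borel_measurable (borel :: (real^'n) measure)"
  by (intro borel_measurable_continuous_onI matrix_vector_mult_linear_continuous_on)

lemma std_normal_moments:
  "integrable (density lborel std_normal_density) (\<lambda>x. x ^ k)"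
  "(\<integral>x. x \<partial>density lborel std_normal_density) = 0"
  "(\<integral>x. x\<^sup>2 \<partial>density lborel std_normal_density) = 1"
  using integrable_std_normal_moment[of k] integral_std_normal_moment_odd[of 0]
    integral_std_normal_moment_even[of 1]
  by (simp_all add: integrable_density integral_density)

text \<open>Both the diagonal and the off-diagonal moments are integrals of a product with one factor per
coordinate, all but at most two of which are constantly 1, so they follow at once from the product rule.\<close>
lemma std_gauss_second_moments:
  fixes i j :: "'n::finite"
  shows "has_bochner_integral std_gauss (\<lambda>z. z i * z j) (if i = j then 1 else 0)"
proof -
  let ?N = "density lborel std_normal_density"
  define f :: "'n \<Rightarrow> real \<Rightarrow> real"
    where "f k x = (if k = i then x else 1) * (if k = j then x else 1)" for k x
  interpret N: prob_space ?N by (rule prob_space_normal_density) simp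
  interpret product_sigma_finite "\<lambda>_::'n. ?N"
    by unfold_locales
  have prod: "(\<Prod>k\<in>UNIV. f k (z k)) = z i * z j" for z
    by (simp add: f_def prod.distrib)
  have int1: "integrable ?N (\<lambda>x. x)" using std_normal_moments(1)[of 1] by simp
  have int2: "integrable ?N (\<lambda>x. x * x)"
    using std_normal_moments(1)[of 2] by (simp add: power2_eq_square)
  have int: "integrable ?N (f k)" for k
    using int1 int2 by (cases "k = i"; cases "k = j") (simp_all add: f_def[abs_def])
  have val: "integral\<^sup>L ?N (f k) = (if k = i \<and> k \<noteq> j \<or> k \<noteq> i \<and> k = j then 0 else 1)" for k
    using std_normal_moments(2,3) N.prob_space
    by (cases "k = i"; cases "k = j") (simp_all add: f_def[abs_def] power2_eq_square)
  have "integrable std_gauss (\<lambda>z. z i * z j)"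
    using product_integrable_prod[of UNIV f] int by (simp add: prod)
  moreover have "(\<integral>z. z i * z j \<partial>std_gauss) = (\<Prod>k\<in>UNIV. integral\<^sup>L ?N (f k))"
    using product_integral_prod[of UNIV f] int by (simp add: prod)
  moreover have "(\<Prod>k\<in>UNIV. integral\<^sup>L ?N (f k)) = (if i = j then 1 else 0)"
  proof (cases "i = j")
    case False
    then have "integral\<^sup>L ?N (f i) = 0" by (simp add: val)
    then show ?thesis using False by (metis UNIV_I finite prod_zero)
  qed (auto simp: val intro!: prod.neutral)
  ultimately show ?thesis by (simp add: has_bochner_integral_iff)
qed

lemma std_gauss_quadratic_form:
  fixes A :: "real^'n^'n"
  shows "has_bochner_integral std_gauss (\<lambda>z. (\<chi> i. z i) \<bullet> (A *v (\<chi> i. z i))) (trace A)"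
proof -
  have "has_bochner_integral std_gauss (\<lambda>z. \<Sum>i\<in>UNIV. \<Sum>j\<in>UNIV. A $ i $ j * (z i * z j))
      (\<Sum>i\<in>UNIV. \<Sum>j\<in>UNIV. A $ i $ j * (if i = j then 1 else 0))"
    by (intro has_bochner_integral_sum has_bochner_integral_mult_right std_gauss_second_moments)
  moreover have "(\<Sum>i\<in>UNIV. \<Sum>j\<in>UNIV. A $ i $ j * (if i = j then 1 else 0)) = trace A"
    by (simp add: trace_def if_distrib[of "\<lambda>a. _ * a"] cong: if_cong)
  moreover have "(\<Sum>i\<in>UNIV. \<Sum>j\<in>UNIV. A $ i $ j * (z i * z j)) = (\<chi> i. z i) \<bullet> (A *v (\<chi> i. z i))" for z
    by (simp add: inner_vec_def matrix_vector_mult_def sum_distrib_left mult_ac)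
  ultimately show ?thesis by simp
qed

lemma frob_outer: "frob (outer x x) A = x \<bullet> (A *v x)"
  unfolding frob_def trace_def outer_def transpose_def matrix_matrix_mult_def inner_vec_def
    matrix_vector_mult_def
  by (simp add: sum_distrib_left mult_ac) (subst sum.swap, simp add: mult_ac)

lemma frob_outer_measurable [measurable]:
  "(\<lambda>x. frob (outer x x) A) \<in> borel_measurable borel"
  unfolding frob_outer by measurable

text \<open>With \<open>R\<close> the matrix \<^term>\<open>psd_sqrt T\<close>, substitute \<open>\<xi> = R z\<close> and expand \<open>Rz\<cdot>ARz\<close>. The trace is kept in
terms of \<open>R\<close> because the optimality argument works with \<open>R\<^sup>T A R\<close> itself. Stated as a Bochner integral, the
lemma also supplies the integrability of quadratic forms under every normal distribution.\<close>
lemma normal0_expectation: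
  fixes T A :: "real^'n^'n"
  shows "has_bochner_integral (normal0 T) (\<lambda>x. frob (outer x x) A)
           (trace (transpose (psd_sqrt T) ** A ** psd_sqrt T))"
proof -
  let ?R = "psd_sqrt T"
  have "(?R *v x) \<bullet> (A *v (?R *v x)) = x \<bullet> ((transpose ?R ** A ** ?R) *v x)" for x
    by (simp add: matrix_vector_mul_assoc[symmetric] dot_lmul_matrix inner_commute)
      (metis dot_lmul_matrix inner_commute)
  then have "has_bochner_integral std_gauss (\<lambda>z. frob (outer (?R *v (\<chi> i. z i)) (?R *v (\<chi> i. z i))) A)
     (trace (transpose ?R ** A ** ?R))"
    using std_gauss_quadratic_form[of "transpose ?R ** A ** ?R"] by (simp add: frob_outer)
  then show ?thesis
    unfolding normal0_def
    by (subst has_bochner_integral_distr) auto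
qed

text \<open>Driving both normal distributions by the same standard normal vector gives a coupling with explicit cost.
For commuting covariance matrices this is the optimal coupling; in general it shows that couplings exist.\<close>
lemma gaussian_coupling:
  fixes S T :: "real^'n^'n"
  defines "C \<equiv> distr std_gauss (borel \<Otimes>\<^sub>M borel)
     (\<lambda>z. (psd_sqrt T *v (\<chi> i. z i), psd_sqrt S *v (\<chi> i. z i)))"
  shows "C \<in> couplings (normal0 T) (normal0 S)"
    and "(\<integral>w. (norm (fst w - snd w))\<^sup>2 \<partial>C)
      = trace (transpose (psd_sqrt T - psd_sqrt S) ** (psd_sqrt T - psd_sqrt S))"
proof -
  interpret G: prob_space "std_gauss :: ('n \<Rightarrow> real) measure" by (rule prob_space_std_gauss)
  show "C \<in> couplings (normal0 T) (normal0 S)"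
    unfolding couplings_def C_def normal0_def
    by (auto intro!: G.prob_space_distr simp: distr_distr comp_def)
  let ?D = "psd_sqrt T - psd_sqrt S"
  have "(norm (psd_sqrt T *v x - psd_sqrt S *v x))\<^sup>2 = x \<bullet> ((transpose ?D ** ?D) *v x)" for x
  proof -
    have "(norm (psd_sqrt T *v x - psd_sqrt S *v x))\<^sup>2 = (?D *v x) \<bullet> (?D *v x)"
      by (simp add: power2_norm_eq_inner matrix_vector_mult_diff_rdistrib)
    also have "\<dots> = x \<bullet> ((transpose ?D ** ?D) *v x)"
      by (simp add: matrix_vector_mul_assoc[symmetric] dot_lmul_matrix) (metis dot_lmul_matrix inner_commute)
    finally show ?thesis .
  qed
  then show "(\<integral>w. (norm (fst w - snd w))\<^sup>2 \<partial>C) = trace (transpose ?D ** ?D)"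
    unfolding C_def
    by (subst integral_distr)
       (auto simp: has_bochner_integral_integral_eq[OF std_gauss_quadratic_form])
qed

lemma wasserstein2_le_coupling:
  assumes "C \<in> couplings P Q"
  shows "wasserstein2 P Q \<le> sqrt (\<integral>w. (norm (fst w - snd w))\<^sup>2 \<partial>C)"
  unfolding wasserstein2_def
  by (rule cINF_lower[OF _ assms]) (auto intro!: bdd_belowI[of _ 0])

section \<open>The equation for the multiplier\<close>

text \<open>For \<open>a \<ge> 0\<close>, the nonnegative root of \<open>t\<^sup>2 + a t = a\<close>. The relation \<open>t\<^sup>2 = a (1 - t)\<close> replaces the square root in all later
computations.\<close>
definition shrinkage :: "real \<Rightarrow> real" where
  "shrinkage a = (sqrt (a\<^sup>2 + 4 * a) - a) / 2"

lemma shrinkage_square: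
  assumes "a \<ge> 0"
  shows "(shrinkage a)\<^sup>2 = a * (1 - shrinkage a)"
proof -
  have "(sqrt (a\<^sup>2 + 4 * a))\<^sup>2 = a\<^sup>2 + 4 * a" using assms by simp
  then show ?thesis by (simp add: shrinkage_def power2_eq_square field_simps)
qed

lemma shrinkage_bounds:
  assumes "a \<ge> 0"
  shows "0 \<le> shrinkage a" "shrinkage a < 1"
proof -
  have "a \<le> sqrt (a\<^sup>2 + 4 * a)" using assms by (intro real_le_rsqrt) simp
  then show "0 \<le> shrinkage a" by (simp add: shrinkage_def)
  have "sqrt (a\<^sup>2 + 4 * a) < sqrt ((a + 2)\<^sup>2)"
    by (simp add: power2_eq_square algebra_simps)
  then show "shrinkage a < 1" using assms by (simp add: shrinkage_def)
qed

text \<open>If \<open>t\<close> decreased while \<open>a\<close> increases, then \<open>t\<^sup>2\<close> would decrease while \<open>a (1 - t)\<close> would not.\<close>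
lemma shrinkage_mono:
  assumes "0 \<le> a" "a \<le> b"
  shows "shrinkage a \<le> shrinkage b"
proof (rule ccontr)
  assume "\<not> ?thesis"
  then have less: "shrinkage b < shrinkage a" by simp
  have "(shrinkage b)\<^sup>2 < (shrinkage a)\<^sup>2"
    using less assms by (intro power_strict_mono shrinkage_bounds) auto
  then have "b * (1 - shrinkage b) < a * (1 - shrinkage a)"
    using assms by (simp add: shrinkage_square)
  also have "\<dots> \<le> b * (1 - shrinkage b)"
    using assms less shrinkage_bounds[of a] by (intro mult_mono) auto
  finally show False by simp
qed

lemma xstar_eq_shrinkage: "xstar lam \<gamma> i = \<gamma> * (1 - shrinkage (lam i * \<gamma>))"
  by (simp add: xstar_def shrinkage_def power_mult_distrib mult_ac)

lemma gamma_eq_iff_shrinkage: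
  fixes lam :: "'n::finite \<Rightarrow> real"
  shows "gamma_eq \<rho> lam \<gamma> \<longleftrightarrow> \<rho>\<^sup>2 * \<gamma> + (\<Sum>i\<in>UNIV. shrinkage (lam i * \<gamma>)) = CARD('n)"
proof -
  have "(\<Sum>i\<in>UNIV. shrinkage (lam i * \<gamma>))
    = 1/2 * (\<Sum>i\<in>UNIV. sqrt ((lam i)\<^sup>2 * \<gamma>\<^sup>2 + 4 * lam i * \<gamma>)) - 1/2 * (\<Sum>i\<in>UNIV. lam i) * \<gamma>"
    by (simp add: shrinkage_def power_mult_distrib sum_subtractf sum_distrib_left sum_distrib_right diff_divide_distrib
        sum_divide_distrib mult_ac)
  then show ?thesis unfolding gamma_eq_def left_diff_distrib by linarith
qed

lemma gamma_eq_unique_solution: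
  fixes lam :: "'n::finite \<Rightarrow> real"
  assumes \<rho>: "\<rho> > 0" and lam: "\<And>i. lam i \<ge> 0"
  shows "\<exists>!\<gamma>. \<gamma> > 0 \<and> gamma_eq \<rho> lam \<gamma>"
proof -
  define g where "g \<gamma> = \<rho>\<^sup>2 * \<gamma> + (\<Sum>i\<in>UNIV. shrinkage (lam i * \<gamma>))" for \<gamma>
  have less: "g a < g b" if "0 \<le> a" "a < b" for a b
    unfolding g_def
    using that \<rho> lam
    by (intro add_less_le_mono sum_mono shrinkage_mono mult_strict_left_mono mult_left_mono) auto
  \<comment> \<open>At \<open>?b\<close> the linear term of \<open>g\<close> alone reaches the required value.\<close>
  let ?b = "CARD('n) / \<rho>\<^sup>2"
  have "\<exists>\<gamma>\<ge>0. \<gamma> \<le> ?b \<and> g \<gamma> = CARD('n)"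
  proof (rule IVT')
    show "g 0 \<le> CARD('n)" by (simp add: g_def shrinkage_def)
    have "0 \<le> (\<Sum>i\<in>UNIV. shrinkage (lam i * ?b))"
      using lam by (intro sum_nonneg shrinkage_bounds) auto
    then show "CARD('n) \<le> g ?b" using \<rho> by (simp add: g_def)
    show "0 \<le> ?b" by simp
    show "continuous_on {0..?b} g"
      unfolding g_def[abs_def] shrinkage_def by (intro continuous_intros) auto
  qed
  then obtain \<gamma> where \<gamma>: "\<gamma> \<ge> 0" "g \<gamma> = CARD('n)" by blast
  have "\<gamma> \<noteq> 0" using \<gamma> by (auto simp: g_def shrinkage_def)
  then have "\<gamma> > 0" using \<gamma> by simp
  moreover have "a = b" if "a > 0" "b > 0" "g a = g b" for a b
    using less[of a b] less[of b a] that by (cases a b rule: linorder_cases) auto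
  ultimately show ?thesis
    using \<gamma>(2) unfolding gamma_eq_iff_shrinkage g_def[symmetric] by metis
qed

section \<open>The worst-case expectation\<close>

text \<open>The squared \<open>i\<close>-th coordinate is the quadratic form of the rank-one matrix \<open>v\<^sub>i v\<^sub>i\<^sup>T\<close>; so its moments are
instances of \<open>normal0_expectation\<close>.\<close>
lemma projection_square_eq_frob:
  "(v i \<bullet> x)\<^sup>2 = frob (outer x x) (spectral_sum v (\<lambda>j. if j = i then 1 else 0))"
  by (simp add: frob_outer quadratic_form_spectral_sum if_distrib[of "\<lambda>a. a * _"] cong: if_cong)

lemma normal0_projection_square_integrable:
  fixes v :: "'n::finite \<Rightarrow> real^'n"
  shows "integrable (normal0 T) (\<lambda>x. (v i \<bullet> x)\<^sup>2)"
  unfolding projection_square_eq_frob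
  using normal0_expectation by (rule integrable.intros)

lemma normal0_projection_second_moment:
  assumes v: "orthonormal v" and lam: "\<And>i. lam i \<ge> 0"
  shows "(\<integral>x. (v i \<bullet> x)\<^sup>2 \<partial>normal0 (spectral_sum v lam)) = lam i"
  unfolding projection_square_eq_frob
    has_bochner_integral_integral_eq[OF normal0_expectation]
  by (simp add: psd_sqrt_spectral_sum[OF v] lam transpose_spectral_sum spectral_sum_mult[OF v]
      trace_spectral_sum[OF v] if_distrib[of "\<lambda>a. a * _"] if_distrib[of "\<lambda>a. _ * a"] cong: if_cong)

text \<open>The right-hand side is the maximum over \<open>a\<close> of the left-hand side; after multiplication by \<open>g - x\<close> the two
differ by the square of \<open>(g - x) a - g b\<close>.\<close>
lemma quadratic_penalty_bound:
  fixes x g a b :: real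
  assumes "x < g"
  shows "x * a\<^sup>2 - g * (a - b)\<^sup>2 \<le> g * x / (g - x) * b\<^sup>2"
proof -
  have "(g - x) * (x * a\<^sup>2 - g * (a - b)\<^sup>2) = g * x * b\<^sup>2 - ((g - x) * a - g * b)\<^sup>2"
    by (simp add: power2_eq_square algebra_simps)
  also have "\<dots> \<le> g * x * b\<^sup>2" by simp
  finally show ?thesis using assms by (simp add: field_simps)
qed

text \<open>The penalized form \<open>\<xi>\<^sub>1\<cdot>X\<^sup>*\<xi>\<^sub>1 - \<gamma> |\<xi>\<^sub>1 - \<xi>\<^sub>2|\<^sup>2\<close> splits into coordinates \<open>a i\<close> of \<open>\<xi>\<^sub>1\<close> and \<open>b i\<close> of \<open>\<xi>\<^sub>2\<close>
with respect to \<open>v\<close>, and for \<open>\<lambda>\<^sub>i > 0\<close> the \<open>i\<close>-th term is at most \<open>k (b i)\<^sup>2\<close> with \<open>k = \<gamma> x\<^sub>i / (\<gamma> - x\<^sub>i)\<close>. The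
expectation of this bound is \<open>k \<lambda>\<^sub>i = t\<^sub>i\<close>, by \<open>t\<^sub>i\<^sup>2 = \<lambda>\<^sub>i \<gamma> (1 - t\<^sub>i)\<close> for \<open>t\<^sub>i = shrinkage (\<lambda>\<^sub>i \<gamma>)\<close>. If \<open>\<lambda>\<^sub>i = 0\<close>, then
\<open>x\<^sub>i = \<gamma>\<close> and the term is unbounded in \<open>a i\<close> as soon as \<open>b i \<noteq> 0\<close>; but then \<open>b i = 0\<close> almost surely.\<close>
lemma coupling_expectation_bound:
  fixes v :: "'n::finite \<Rightarrow> real^'n"
  assumes v: "orthonormal v" and lam: "\<And>i. lam i \<ge> 0" and \<gamma>: "\<gamma> > 0"
    and C: "C \<in> couplings (normal0 T) (normal0 (spectral_sum v lam))"
  shows "(\<integral>\<xi>. frob (outer \<xi> \<xi>) (spectral_sum v (xstar lam \<gamma>)) \<partial>normal0 T)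
    \<le> \<gamma> * (\<integral>w. (norm (fst w - snd w))\<^sup>2 \<partial>C) + (\<Sum>i\<in>UNIV. shrinkage (lam i * \<gamma>))"
proof -
  let ?S = "spectral_sum v lam"
  have sC [measurable_cong]: "sets C = sets (borel \<Otimes>\<^sub>M borel)" and C1: "normal0 T = distr C borel fst"
    and C2: "normal0 ?S = distr C borel snd"
    using C by (auto simp: couplings_def)
  define a where "a i w = v i \<bullet> fst w" for i and w :: "(real^'n) \<times> (real^'n)"
  define b where "b i w = v i \<bullet> snd w" for i and w :: "(real^'n) \<times> (real^'n)"
  have [measurable]: "a i \<in> borel_measurable C" "b i \<in> borel_measurable C" for i
    unfolding a_def[abs_def] b_def[abs_def] by measurable
  have int_a: "integrable C (\<lambda>w. (a i w)\<^sup>2)" for i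
    using normal0_projection_square_integrable[where T = T and v = v and i = i] unfolding C1 a_def
    by (subst (asm) integrable_distr_eq) auto
  have int_b: "integrable C (\<lambda>w. (b i w)\<^sup>2)" for i
    using normal0_projection_square_integrable[where T = ?S and v = v and i = i] unfolding C2 b_def
    by (subst (asm) integrable_distr_eq) auto
  have E_b: "(\<integral>w. (b i w)\<^sup>2 \<partial>C) = lam i" for i
    using normal0_projection_second_moment[where lam = lam and i = i, OF v lam] unfolding C2 b_def
    by (subst (asm) integral_distr) auto
  have int_ab: "integrable C (\<lambda>w. (a i w - b i w)\<^sup>2)" for i
  proof (rule Bochner_Integration.integrable_bound)
    show "integrable C (\<lambda>w. 2 * (a i w)\<^sup>2 + 2 * (b i w)\<^sup>2)"
      by (intro Bochner_Integration.integrable_add integrable_mult_right int_a int_b)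
    have "(r - s)\<^sup>2 \<le> 2 * r\<^sup>2 + 2 * s\<^sup>2" for r s :: real
      using zero_le_power2[of "r + s"] by (simp add: power2_eq_square algebra_simps)
    then show "AE w in C. norm ((a i w - b i w)\<^sup>2) \<le> norm (2 * (a i w)\<^sup>2 + 2 * (b i w)\<^sup>2)"
      by simp
  qed measurable
  let ?x = "xstar lam \<gamma>"
  have coord: "(\<integral>w. ?x i * (a i w)\<^sup>2 - \<gamma> * (a i w - b i w)\<^sup>2 \<partial>C) \<le> shrinkage (lam i * \<gamma>)" for i
  proof -
    let ?t = "shrinkage (lam i * \<gamma>)"
    let ?k = "\<gamma> * ?x i / (\<gamma> - ?x i)"
    have l0: "lam i * \<gamma> \<ge> 0" using lam \<gamma> by simp
    have sq: "?t * ?t = lam i * \<gamma> * (1 - ?t)"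
      using shrinkage_square[OF l0] by (simp add: power2_eq_square)
    have xg: "\<gamma> - ?x i = \<gamma> * ?t" by (simp add: xstar_eq_shrinkage algebra_simps)
    \<comment> \<open>For \<open>lam i = 0\<close> the quotient \<open>?k\<close> is a division by zero, hence 0, which is the right constant there.\<close>
    have "AE w in C. ?x i * (a i w)\<^sup>2 - \<gamma> * (a i w - b i w)\<^sup>2 \<le> ?k * (b i w)\<^sup>2"
    proof (cases "lam i = 0")
      case True
      then have "(\<integral>w. (b i w)\<^sup>2 \<partial>C) = 0" by (simp add: E_b)
      then have "AE w in C. (b i w)\<^sup>2 = 0"
        by (subst (asm) integral_nonneg_eq_0_iff_AE[OF int_b]) auto
      moreover have "?x i = \<gamma>" using True by (simp add: xstar_eq_shrinkage shrinkage_def)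
      ultimately show ?thesis by (auto elim!: eventually_mono)
    next
      case False
      then have "?t \<noteq> 0" using sq \<gamma> by auto
      then have "?x i < \<gamma>"
        using shrinkage_bounds(1)[OF l0] \<gamma> xg by (metis diff_gt_0_iff_gt less_le mult_pos_pos)
      then show ?thesis by (intro AE_I2 quadratic_penalty_bound)
    qed
    then have "(\<integral>w. ?x i * (a i w)\<^sup>2 - \<gamma> * (a i w - b i w)\<^sup>2 \<partial>C) \<le> (\<integral>w. ?k * (b i w)\<^sup>2 \<partial>C)"
      by (intro integral_mono_AE Bochner_Integration.integrable_diff integrable_mult_right int_a int_b int_ab)
    also have "\<dots> = ?k * lam i" by (simp add: E_b)
    also have "\<dots> = ?t"
    proof (cases "?t = 0")
      case False
      have "?k * lam i = (lam i * \<gamma> * (1 - ?t)) / ?t"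
        unfolding xg using \<gamma> by (simp add: xstar_eq_shrinkage)
      then show ?thesis using False by (simp add: sq[symmetric])
    qed (use xg in simp)
    finally show ?thesis .
  qed
  have E_T: "(\<integral>\<xi>. frob (outer \<xi> \<xi>) (spectral_sum v ?x) \<partial>normal0 T)
      = (\<integral>w. (\<Sum>i\<in>UNIV. ?x i * (a i w)\<^sup>2) \<partial>C)"
    unfolding C1 by (subst integral_distr) (auto simp: frob_outer quadratic_form_spectral_sum a_def)
  have E_norm: "(\<integral>w. (norm (fst w - snd w))\<^sup>2 \<partial>C) = (\<integral>w. (\<Sum>i\<in>UNIV. (a i w - b i w)\<^sup>2) \<partial>C)"
  proof (intro Bochner_Integration.integral_cong refl)
    fix w :: "(real^'n) \<times> (real^'n)"
    show "(norm (fst w - snd w))\<^sup>2 = (\<Sum>i\<in>UNIV. (a i w - b i w)\<^sup>2)"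
      using orthonormal_parseval[OF v, of "fst w - snd w" "fst w - snd w"]
      unfolding power2_norm_eq_inner
      by (simp only: inner_diff_right[of "v _"] a_def b_def power2_eq_square)
  qed
  have E_sum: "(\<Sum>i\<in>UNIV. \<integral>w. ?x i * (a i w)\<^sup>2 - \<gamma> * (a i w - b i w)\<^sup>2 \<partial>C)
      = (\<integral>w. (\<Sum>i\<in>UNIV. ?x i * (a i w)\<^sup>2) \<partial>C) - \<gamma> * (\<integral>w. (\<Sum>i\<in>UNIV. (a i w - b i w)\<^sup>2) \<partial>C)"
    by (simp add: int_a int_ab sum_subtractf sum_distrib_left)
  have E_le: "(\<Sum>i\<in>UNIV. \<integral>w. ?x i * (a i w)\<^sup>2 - \<gamma> * (a i w - b i w)\<^sup>2 \<partial>C)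
      \<le> (\<Sum>i\<in>UNIV. shrinkage (lam i * \<gamma>))"
    by (intro sum_mono coord)
  show ?thesis unfolding E_T E_norm using E_sum E_le by linarith
qed

text \<open>A bound for all couplings passes to the infimum that defines the distance. The infimum of an empty set
would be unspecified, hence the premise that couplings exist.\<close>
lemma le_of_wasserstein2_le:
  assumes W: "wasserstein2 P Q \<le> \<rho>" and nonempty: "couplings P Q \<noteq> {}" and \<gamma>: "\<gamma> > 0"
    and le: "\<And>C. C \<in> couplings P Q \<Longrightarrow> e \<le> \<gamma> * (\<integral>w. (norm (fst w - snd w))\<^sup>2 \<partial>C)"
  shows "e \<le> \<gamma> * \<rho>\<^sup>2"
proof -
  have "sqrt (e / \<gamma>) \<le> wasserstein2 P Q"
    unfolding wasserstein2_def
  proof (rule cINF_greatest[OF nonempty])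
    fix C assume "C \<in> couplings P Q"
    from le[OF this] show "sqrt (e / \<gamma>) \<le> sqrt (\<integral>w. (norm (fst w - snd w))\<^sup>2 \<partial>C)"
      using \<gamma> by (simp add: divide_le_eq mult.commute)
  qed
  with W have "sqrt (e / \<gamma>) \<le> \<rho>" by simp
  then have "e / \<gamma> \<le> \<rho>\<^sup>2" by (rule sqrt_le_D)
  then show ?thesis using \<gamma> by (simp add: divide_le_eq mult.commute)
qed

text \<open>The Lagrangian bound \<open>\<gamma> \<rho>\<^sup>2 + \<Sum> t\<^sub>i\<close> equals the dimension by the equation for \<open>\<gamma>\<close>.\<close>
lemma worst_case_expectation_le:
  fixes v :: "'n::finite \<Rightarrow> real^'n"
  assumes v: "orthonormal v" and lam: "\<And>i. lam i \<ge> 0" and \<gamma>: "\<gamma> > 0" "gamma_eq \<rho> lam \<gamma>"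
    and Q: "Q \<in> ambiguity \<rho> (spectral_sum v lam)"
  shows "(\<integral>\<xi>. frob (outer \<xi> \<xi>) (spectral_sum v (xstar lam \<gamma>)) \<partial>Q) \<le> CARD('n)"
proof -
  obtain T where T: "Q = normal0 T" using Q by (auto simp: ambiguity_def normals0_def)
  let ?t = "\<Sum>i\<in>UNIV. shrinkage (lam i * \<gamma>)"
  let ?e = "(\<integral>\<xi>. frob (outer \<xi> \<xi>) (spectral_sum v (xstar lam \<gamma>)) \<partial>Q) - ?t"
  have "?e \<le> \<gamma> * \<rho>\<^sup>2"
  proof (rule le_of_wasserstein2_le)
    show "wasserstein2 Q (normal0 (spectral_sum v lam)) \<le> \<rho>" using Q by (simp add: ambiguity_def)
    show "couplings Q (normal0 (spectral_sum v lam)) \<noteq> {}" using gaussian_coupling(1) T by blast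
    show "?e \<le> \<gamma> * (\<integral>w. (norm (fst w - snd w))\<^sup>2 \<partial>C)"
      if "C \<in> couplings Q (normal0 (spectral_sum v lam))" for C
      using coupling_expectation_bound[where lam = lam, OF v lam \<gamma>(1) that[unfolded T]] by (simp add: T)
  qed fact
  then show ?thesis using \<gamma>(2) by (simp add: gamma_eq_iff_shrinkage mult.commute)
qed

lemma xstar_pos:
  assumes "lam i \<ge> 0" "\<gamma> > 0"
  shows "xstar lam \<gamma> i > 0"
  using assms shrinkage_bounds(2)[of "lam i * \<gamma>"] by (simp add: xstar_eq_shrinkage)

text \<open>Writing \<open>t\<^sub>i\<close> for the shrinkage, \<open>\<lambda>\<^sub>i = t\<^sub>i\<^sup>2 / x\<^sub>i\<close>. Hence \<open>\<surd>(1 / x\<^sub>i) - \<surd>\<lambda>\<^sub>i = (1 - t\<^sub>i) \<surd>(1 / x\<^sub>i)\<close> has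
square \<open>(1 - t\<^sub>i) / \<gamma>\<close>, and the equation for \<open>\<gamma>\<close> says that these squares sum to \<open>\<rho>\<^sup>2\<close>.\<close>
lemma worst_case_distribution_mem_ambiguity:
  fixes v :: "'n::finite \<Rightarrow> real^'n"
  assumes v: "orthonormal v" and lam: "\<And>i. lam i \<ge> 0" and \<rho>: "\<rho> > 0"
    and \<gamma>: "\<gamma> > 0" "gamma_eq \<rho> lam \<gamma>"
  shows "normal0 (spectral_sum v (\<lambda>i. 1 / xstar lam \<gamma> i)) \<in> ambiguity \<rho> (spectral_sum v lam)"
proof -
  let ?T = "spectral_sum v (\<lambda>i. 1 / xstar lam \<gamma> i)" and ?S = "spectral_sum v lam"
  have x: "xstar lam \<gamma> i > 0" for i by (rule xstar_pos[where lam = lam, OF lam \<gamma>(1)])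
  have cost: "(sqrt (1 / xstar lam \<gamma> i) - sqrt (lam i))\<^sup>2 = (1 - shrinkage (lam i * \<gamma>)) / \<gamma>" for i
  proof -
    define t where "t = shrinkage (lam i * \<gamma>)"
    have t: "t\<^sup>2 = lam i * \<gamma> * (1 - t)" "0 \<le> t" "t < 1"
      unfolding t_def using lam[of i] \<gamma> by (auto intro: shrinkage_square shrinkage_bounds)
    have "lam i = t\<^sup>2 * (1 / xstar lam \<gamma> i)"
      using t \<gamma> by (simp add: xstar_eq_shrinkage t_def[symmetric])
    then have "sqrt (lam i) = t * sqrt (1 / xstar lam \<gamma> i)"
      using t(2) by (metis real_sqrt_mult real_sqrt_unique)
    then have "(sqrt (1 / xstar lam \<gamma> i) - sqrt (lam i))\<^sup>2 = ((1 - t) * sqrt (1 / xstar lam \<gamma> i))\<^sup>2"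
      by (simp add: algebra_simps)
    also have "\<dots> = (1 - t)\<^sup>2 * (1 / xstar lam \<gamma> i)"
      using x[of i] by (simp add: power_mult_distrib)
    also have "\<dots> = (1 - t) / \<gamma>"
      using t \<gamma> by (simp add: xstar_eq_shrinkage t_def[symmetric] power2_eq_square)
    finally show ?thesis by (simp add: t_def)
  qed
  have sqrt_diff: "psd_sqrt ?T - psd_sqrt ?S
      = spectral_sum v (\<lambda>i. sqrt (1 / xstar lam \<gamma> i) - sqrt (lam i))"
    using x lam
    by (simp add: psd_sqrt_spectral_sum[OF v] less_imp_le)
       (simp add: spectral_sum_def sum_subtractf scaleR_diff_left)
  have "trace (transpose (psd_sqrt ?T - psd_sqrt ?S) ** (psd_sqrt ?T - psd_sqrt ?S))
      = (\<Sum>i\<in>UNIV. (1 - shrinkage (lam i * \<gamma>)) / \<gamma>)"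
    unfolding sqrt_diff
    by (simp add: transpose_spectral_sum spectral_sum_mult[OF v] trace_spectral_sum[OF v]
        cost[unfolded power2_eq_square])
  also have "\<dots> = (CARD('n) - (\<Sum>i\<in>UNIV. shrinkage (lam i * \<gamma>))) / \<gamma>"
    by (simp add: sum_divide_distrib[symmetric] sum_subtractf)
  also have "\<dots> = \<rho>\<^sup>2"
    using \<gamma> by (simp add: gamma_eq_iff_shrinkage field_simps)
  finally have "wasserstein2 (normal0 ?T) (normal0 ?S) \<le> \<rho>"
    using wasserstein2_le_coupling[OF gaussian_coupling(1)[of ?T ?S]] \<rho>
    unfolding gaussian_coupling(2) by simp
  moreover have "?T \<in> psd" using x by (intro spectral_sum_mem_psd) (simp add: less_imp_le)
  ultimately show ?thesis by (simp add: ambiguity_def normals0_def)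
qed

section \<open>The saddle point\<close>

lemma objective_ge_worst_case:
  fixes v :: "'n::finite \<Rightarrow> real^'n"
  assumes v: "orthonormal v" and lam: "\<And>i. lam i \<ge> 0" and \<rho>: "\<rho> > 0"
    and \<gamma>: "\<gamma> > 0" "gamma_eq \<rho> lam \<gamma>"
  defines "A \<equiv> spectral_sum v (\<lambda>i. sqrt (1 / xstar lam \<gamma> i))"
  shows "ereal (trace (A ** X ** A) - ln (det X)) \<le> objective \<rho> (spectral_sum v lam) X"
proof -
  let ?Q = "normal0 (spectral_sum v (\<lambda>i. 1 / xstar lam \<gamma> i))"
  have "psd_sqrt (spectral_sum v (\<lambda>i. 1 / xstar lam \<gamma> i)) = A"
    unfolding A_def using xstar_pos[where lam = lam, OF lam \<gamma>(1)]
    by (intro psd_sqrt_spectral_sum[OF v]) (simp add: less_imp_le)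
  then have "(\<integral>\<xi>. frob (outer \<xi> \<xi>) X \<partial>?Q) = trace (A ** X ** A)"
    using has_bochner_integral_integral_eq[OF normal0_expectation, of _ X]
    by (simp add: A_def transpose_spectral_sum)
  moreover have "ereal (\<integral>\<xi>. frob (outer \<xi> \<xi>) X \<partial>?Q)
      \<le> (SUP Q\<in>ambiguity \<rho> (spectral_sum v lam). ereal (\<integral>\<xi>. frob (outer \<xi> \<xi>) X \<partial>Q))"
    by (rule SUP_upper) (rule worst_case_distribution_mem_ambiguity[where lam = lam, OF v lam \<rho> \<gamma>])
  ultimately have "ereal (- ln (det X)) + ereal (trace (A ** X ** A)) \<le> objective \<rho> (spectral_sum v lam) X"
    unfolding objective_def by (intro add_left_mono) simp
  then show ?thesis by simp
qed

lemma objective_xstar_le: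
  fixes v :: "'n::finite \<Rightarrow> real^'n"
  assumes v: "orthonormal v" and lam: "\<And>i. lam i \<ge> 0" and \<gamma>: "\<gamma> > 0" "gamma_eq \<rho> lam \<gamma>"
  defines "X \<equiv> spectral_sum v (xstar lam \<gamma>)"
  shows "objective \<rho> (spectral_sum v lam) X \<le> ereal (CARD('n) - ln (det X))"
proof -
  have "(SUP Q\<in>ambiguity \<rho> (spectral_sum v lam). ereal (\<integral>\<xi>. frob (outer \<xi> \<xi>) X \<partial>Q)) \<le> ereal CARD('n)"
    unfolding X_def using worst_case_expectation_le[where lam = lam, OF v lam \<gamma>] by (intro SUP_least) simp
  then have "objective \<rho> (spectral_sum v lam) X \<le> ereal (- ln (det X)) + ereal CARD('n)"
    unfolding objective_def by (rule add_left_mono)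
  then show ?thesis by simp
qed

theorem theorem3p1:
  fixes \<rho> :: real
    and S :: "real^'n^'n"
    and lam :: "'n \<Rightarrow> real"
    and v :: "'n \<Rightarrow> real^'n"
  assumes "\<rho> > 0"
    and "S \<in> psd"
    and "\<And>i j. v i \<bullet> v j = (if i = j then 1 else 0)"
    and "S = (\<Sum>i\<in>UNIV. lam i *\<^sub>R outer (v i) (v i))"
  shows "(\<exists>!\<gamma>. \<gamma> > 0 \<and> gamma_eq \<rho> lam \<gamma>) \<and>
    (\<forall>\<gamma>. \<gamma> > 0 \<and> gamma_eq \<rho> lam \<gamma> \<longrightarrow>
      {X. is_arg_min (objective \<rho> S) (\<lambda>X. X \<in> pd) X}
        = {\<Sum>i\<in>UNIV. xstar lam \<gamma> i *\<^sub>R outer (v i) (v i)})"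
proof -
  have v: "orthonormal v" using assms(3) by (simp add: orthonormal_def)
  have S: "S = spectral_sum v lam" using assms(4) by (simp add: spectral_sum_def)
  have lam: "lam i \<ge> 0" for i
  proof -
    have "0 \<le> v i \<bullet> (S *v v i)" using assms(2) by (simp add: psd_def)
    then show ?thesis by (simp add: S spectral_sum_eigenvector[OF v] orthonormal_inner[OF v])
  qed
  have "{X. is_arg_min (objective \<rho> S) (\<lambda>X. X \<in> pd) X} = {spectral_sum v (xstar lam \<gamma>)}"
    if \<gamma>: "\<gamma> > 0" "gamma_eq \<rho> lam \<gamma>" for \<gamma>
  proof -
    let ?X = "spectral_sum v (xstar lam \<gamma>)"
    let ?A = "spectral_sum v (\<lambda>i. sqrt (1 / xstar lam \<gamma> i))"
    note x = xstar_pos[where lam = lam, OF lam \<gamma>(1)]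
    have X_pd: "?X \<in> pd" by (rule spectral_sum_mem_pd[where d = "xstar lam \<gamma>", OF v x])
    note upper = objective_xstar_le[where lam = lam, OF v lam \<gamma>, folded S]
    note lower = objective_ge_worst_case[where lam = lam, OF v lam assms(1) \<gamma>, folded S]
    note bound = log_det_trace_bound[where x = "xstar lam \<gamma>", OF v x]
    have "\<not> objective \<rho> S X < objective \<rho> S ?X" if X: "X \<in> pd" for X
    proof -
      have "ereal (CARD('n) - ln (det ?X)) \<le> ereal (trace (?A ** X ** ?A) - ln (det X))"
        using bound(1)[OF X] by simp
      with upper lower[of X] show ?thesis by (meson leD order_trans)
    qed
    moreover have "X = ?X" if X: "X \<in> pd" and le: "\<not> objective \<rho> S ?X < objective \<rho> S X" for X
    proof -
      have "ereal (trace (?A ** X ** ?A) - ln (det X)) \<le> ereal (CARD('n) - ln (det ?X))"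
        using lower[of X] le upper by (meson not_less order_trans)
      with bound(1)[OF X] have "trace (?A ** X ** ?A) - ln (det X) = CARD('n) - ln (det ?X)"
        by simp
      then show ?thesis by (rule bound(2)[OF X])
    qed
    ultimately show ?thesis using X_pd by (auto simp: is_arg_min_def)
  qed
  then show ?thesis
    using gamma_eq_unique_solution[where lam = lam, OF assms(1) lam] by (simp add: spectral_sum_def)
qed

end
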